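(* Let $w$ be a word of length $n!$ over $\Sigma_n$. Then $w$ is a universal Lyndon word if and only if every conjugate $w_i$ of $w$ is a Lyndon word with respect to the order $\triangleleft_{w_i}$ it defines, i.e. $w_i$ is strictly lexicographically smaller than each of its proper conjugates when letters are ordered by $\triangleleft_{w_i}$ (first occurrence in $w_i$).
   Context: $\Sigma_n=\{1,\ldots,n\}$. For a word $w=a_1\cdots a_m$ its conjugates are $w_i=a_i\cdots a_m a_1\cdots a_{i-1}$; a proper conjugate is $w_2w_1$ where $w=w_1w_2$ with $w_1,w_2$ nonempty. A total order on the alphabet induces the lexicographic order on words ($u$ is smaller than $v$ if $u$ is a proper prefix of $v$, or $u=zau'$, $v=zbv'$ with letters $a<b$). A word $w$ over $\Sigma_n$ is a Lyndon word if there is a total order on $\Sigma_n$ for which $w$ is strictly lexicographically smaller than each of its proper conjugates. A universal Lyndon word of degree $n$ is a word over $\Sigma_n$ of length $n!$ all of whose conjugates are Lyndon words. For a nonempty word $u$, $\mathrm{alp}(u)$ is the set of letters occurring in $u$, and $\triangleleft_u$ is the relation on $\Sigma_n$ given by $i\triangleleft_u j$ iff $i\in\mathrm{alp}(u)$ and either $j\notin\mathrm{alp}(u)$ or the first occurrence of $i$ in $u$ precedes the first occurrence of $j$ in $u$. All conjugates of $w$ have the same letters, so $\triangleleft_{w_i}$ is a total order on the letters occurring in $w$, which suffices to compare conjugates of $w$ lexicographically. *)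

theory Defs
  imports Main
begin

definition is_word :: "nat \<Rightarrow> nat list \<Rightarrow> bool" where
  "is_word n w \<longleftrightarrow> set w \<subseteq> {1..n}"

text \<open>The \<open>i\<close>-th conjugate, with \<open>i\<close> counted from 1: \<open>a\<^sub>i \<dots> a\<^sub>m a\<^sub>1 \<dots> a\<^sub>i\<^sub>-\<^sub>1\<close>.\<close>

definition conjugate :: "nat list \<Rightarrow> nat \<Rightarrow> nat list" where
  "conjugate w i = drop (i - 1) w @ take (i - 1) w"

definition strict_total_order :: "nat \<Rightarrow> nat rel \<Rightarrow> bool" where
  "strict_total_order n r \<longleftrightarrow> r \<subseteq> {1..n} \<times> {1..n} \<and> strict_linear_order_on {1..n} r"

text \<open>The relation \<open>r\<close> is a strict order on letters, and \<^const>\<open>lexord\<close> is the induced strict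
  lexicographic order in which a proper prefix is smaller. Totality of \<open>r\<close> is not built in:
  a relation that is total only on the letters of \<open>w\<close> is allowed.\<close>

definition lyndon_wrt :: "nat rel \<Rightarrow> nat list \<Rightarrow> bool" where
  "lyndon_wrt r w \<longleftrightarrow>
     (\<forall>u v. w = u @ v \<and> u \<noteq> [] \<and> v \<noteq> [] \<longrightarrow> (w, v @ u) \<in> lexord r)"

definition lyndon :: "nat \<Rightarrow> nat list \<Rightarrow> bool" where
  "lyndon n w \<longleftrightarrow> is_word n w \<and> (\<exists>r. strict_total_order n r \<and> lyndon_wrt r w)"

definition universal_lyndon :: "nat \<Rightarrow> nat list \<Rightarrow> bool" where
  "universal_lyndon n w \<longleftrightarrow>
     is_word n w \<and> length w = fact n \<and> (\<forall>i\<in>{1..length w}. lyndon n (conjugate w i))"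

definition first_occ :: "nat list \<Rightarrow> nat \<Rightarrow> nat" where
  "first_occ u a = (LEAST k. k < length u \<and> u ! k = a)"

definition occ_order :: "nat \<Rightarrow> nat list \<Rightarrow> nat rel" where
  "occ_order n u = {(i, j). i \<in> {1..n} \<and> j \<in> {1..n} \<and>
     i \<in> set u \<and> (j \<notin> set u \<or> first_occ u i < first_occ u j)}"

end

theory Submission
  imports Defs "HOL-Combinatorics.Permutations"
begin

text \<open>
  A strict total order admits at most one Lyndon conjugate, and there are \<open>n!\<close> orders and \<open>n!\<close>
  conjugates; hence in a universal Lyndon word every order \<open>r\<close> is realised by some conjugate. Apply
  this to a total order \<open>r\<close> extending \<open>\<triangleleft>\<^sub>u\<close>, for a conjugate \<open>u\<close>. If the conjugate
  \<open>u'\<close> realising \<open>r\<close> were not \<open>u\<close>, then \<open>u = z p \<dots>\<close> and \<open>u' = z q \<dots>\<close> with \<open>q\<close> before \<open>p\<close>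
  in \<open>r\<close>, so \<open>q\<close> occurs in \<open>z\<close>. Dropping a prefix of \<open>z\<close>, we get conjugates \<open>v = q s p \<dots>\<close> and
  \<open>v' = q s q \<dots>\<close>. The order making \<open>v\<close> Lyndon has \<open>q\<close> below \<open>p\<close> since \<open>v\<close> starts with \<open>q\<close>,
  but also \<open>p\<close> below \<open>q\<close> since \<open>v\<close> is smaller than \<open>v'\<close>, a contradiction.
\<close>

section \<open>Lexicographic comparison and first occurrences\<close>

lemma lexord_mono_on:
  assumes "(x, y) \<in> lexord r"
    and "\<And>a b. \<lbrakk>a \<in> set x; b \<in> set y; (a, b) \<in> r\<rbrakk> \<Longrightarrow> (a, b) \<in> s"
  shows "(x, y) \<in> lexord s"
proof -
  from assms(1) consider (pre) a v where "y = x @ a # v"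
    | (diff) u a b v z where "(a, b) \<in> r" "x = u @ a # v" "y = u @ b # z"
    unfolding lexord_def by blast
  then show ?thesis
  proof cases
    case pre then show ?thesis unfolding lexord_def by blast
  next
    case diff
    with assms(2)[of a b] have "(a, b) \<in> s" by simp
    with diff show ?thesis unfolding lexord_def by blast
  qed
qed

lemma lexord_same_length_index:
  assumes "(x, y) \<in> lexord r" and "length x = length y"
  obtains k where "k < length x" "take k x = take k y" "(x ! k, y ! k) \<in> r"
  using assms unfolding lexord_take_index_conv by auto

lemma nth_first_occ:
  assumes "a \<in> set u"
  shows "first_occ u a < length u" "u ! first_occ u a = a"
proof -
  have "\<exists>k. k < length u \<and> u ! k = a" using assms by (simp add: in_set_conv_nth)
  from LeastI_ex[OF this] show "first_occ u a < length u" "u ! first_occ u a = a"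
    unfolding first_occ_def by blast+
qed

lemma first_occ_le: "k < length u \<Longrightarrow> first_occ u (u ! k) \<le> k"
  unfolding first_occ_def by (rule Least_le) simp

section \<open>Strict total orders and their number\<close>

lemma strict_total_orderD:
  assumes "strict_total_order n r"
  shows "trans r" "irrefl r" "total_on {1..n} r" "r \<subseteq> {1..n} \<times> {1..n}"
  using assms by (auto simp: strict_total_order_def strict_linear_order_on_def)

lemma strict_total_order_key:
  fixes f :: "nat \<Rightarrow> nat"
  assumes "inj_on f {1..n}"
  shows "strict_total_order n {(i, j). i \<in> {1..n} \<and> j \<in> {1..n} \<and> f i < f j}"
proof -
  let ?r = "{(i, j). i \<in> {1..n} \<and> j \<in> {1..n} \<and> f i < f j}"
  have "trans ?r" by (rule transI) auto
  moreover have "irrefl ?r" by (rule irreflI) auto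
  moreover have "total_on {1..n} ?r"
  proof (rule total_onI)
    fix i j assume "i \<in> {1..n}" "j \<in> {1..n}" "i \<noteq> j"
    moreover from this have "f i \<noteq> f j" using assms by (metis inj_onD)
    ultimately show "(i, j) \<in> ?r \<or> (j, i) \<in> ?r" by (simp add: neq_iff)
  qed
  moreover have "?r \<subseteq> {1..n} \<times> {1..n}" by auto
  ultimately show ?thesis
    unfolding strict_total_order_def strict_linear_order_on_def by blast
qed

lemma finite_strict_total_orders: "finite {r. strict_total_order n r}"
  by (rule finite_subset[of _ "Pow ({1..n} \<times> {1..n})"]) (auto simp: strict_total_order_def)

text \<open>A total order is determined by its rank function, which is a permutation.\<close>

lemma card_strict_total_orders_le: "card {r. strict_total_order n r} \<le> fact n"
proof -
  \<comment> \<open>\<open>Suc\<close> moves the ranks from 0..n-1 to 1..n, and the identity outside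
    \<open>{1..n}\<close> is what \<open>permutes\<close> demands.\<close>
  define rank where
    "rank r a = (if a \<in> {1..n} then Suc (card {b. (b, a) \<in> r}) else a)" for r :: "nat rel" and a
  have mono: "rank r a < rank r b" if r: "strict_total_order n r" and ab: "(a, b) \<in> r" for r a b
  proof -
    note D = strict_total_orderD[OF r]
    have "finite {c. (c, b) \<in> r}"
      by (rule finite_subset[of _ "{1..n}"]) (use D(4) in auto)
    moreover have "{c. (c, a) \<in> r} \<subset> {c. (c, b) \<in> r}"
      using D(1,2) ab by (auto simp: irrefl_def dest: transD)
    ultimately have "card {c. (c, a) \<in> r} < card {c. (c, b) \<in> r}"
      by (rule psubset_card_mono)
    with ab D(4) show ?thesis by (auto simp: rank_def)
  qed
  have iff: "(a, b) \<in> r \<longleftrightarrow> rank r a < rank r b"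
    if "strict_total_order n r" "a \<in> {1..n}" "b \<in> {1..n}" for r a b
  proof
    assume less: "rank r a < rank r b"
    then have "a \<noteq> b" by auto
    then have "(a, b) \<in> r \<or> (b, a) \<in> r"
      using strict_total_orderD(3)[OF that(1)] that(2,3) unfolding total_on_def by blast
    then show "(a, b) \<in> r" using mono[OF that(1), of b a] less by auto
  qed (rule mono[OF that(1)])
  have "rank r permutes {1..n}" if r: "strict_total_order n r" for r
  proof (rule bij_imp_permutes)
    note D = strict_total_orderD[OF r]
    have inj: "inj_on (rank r) {1..n}"
    proof (rule inj_onI)
      fix a b assume *: "a \<in> {1..n}" "b \<in> {1..n}" "rank r a = rank r b"
      with iff[OF r, of a b] iff[OF r, of b a] have "(a, b) \<notin> r" "(b, a) \<notin> r" by simp_all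
      with D(3) * show "a = b" unfolding total_on_def by blast
    qed
    have "rank r a \<in> {1..n}" if a: "a \<in> {1..n}" for a
    proof -
      \<comment> \<open>Irreflexivity removes \<open>a\<close> itself, leaving at most n-1
        predecessors, so the rank stays at most n.\<close>
      have "{b. (b, a) \<in> r} \<subseteq> {1..n} - {a}"
        using D(2,4) by (auto simp: irrefl_def)
      then have "card {b. (b, a) \<in> r} \<le> card ({1..n} - {a})" by (intro card_mono) auto
      with a show ?thesis by (auto simp: rank_def)
    qed
    then have "rank r ` {1..n} \<subseteq> {1..n}" by blast
    with inj show "bij_betw (rank r) {1..n} {1..n}"
      by (simp add: bij_betw_def endo_inj_surj)
  qed (auto simp: rank_def)
  moreover have "inj_on rank {r. strict_total_order n r}"
  proof (rule inj_onI)
    fix r s assume "r \<in> {r. strict_total_order n r}" "s \<in> {r. strict_total_order n r}"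
      and eq: "rank r = rank s"
    then have rs: "strict_total_order n r" "strict_total_order n s" by auto
    have "(a, b) \<in> r \<longleftrightarrow> (a, b) \<in> s" for a b
      using iff[OF rs(1), of a b] iff[OF rs(2), of a b] eq
        strict_total_orderD(4)[OF rs(1)] strict_total_orderD(4)[OF rs(2)] by auto
    then show "r = s" by auto
  qed
  ultimately have "card {r. strict_total_order n r} \<le> card {p. p permutes {1..n}}"
    by (intro card_inj_on_le[of rank]) (auto simp: finite_permutations)
  also have "\<dots> = fact n" by (rule card_permutations) auto
  finally show ?thesis .
qed

section \<open>Conjugates as rotations\<close>

lemma conjugate_eq_rotate:
  assumes "i \<in> {1..length w}"
  shows "conjugate w i = rotate (i - 1) w"
proof -
  have "(i - 1) mod length w = i - 1" using assms by auto
  then show ?thesis by (simp only: conjugate_def rotate_drop_take)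
qed

lemma all_conjugates_iff:
  "(\<forall>i\<in>{1..length w}. P (conjugate w i)) \<longleftrightarrow> (\<forall>i<length w. P (rotate i w))"
proof -
  have "(\<forall>i\<in>{1..length w}. P (conjugate w i)) \<longleftrightarrow> (\<forall>i\<in>{1..length w}. P (rotate (i - 1) w))"
    by (simp only: conjugate_eq_rotate cong: ball_cong)
  also have "\<dots> \<longleftrightarrow> (\<forall>i\<in>(\<lambda>i. i - 1) ` {1..length w}. P (rotate i w))" by simp
  also have "(\<lambda>i. i - 1) ` {1..length w} = {..<length w}"
  proof
    show "{..<length w} \<subseteq> (\<lambda>i. i - 1) ` {1..length w}"
    proof
      fix i assume "i \<in> {..<length w}"
      then show "i \<in> (\<lambda>i. i - 1) ` {1..length w}"
        by (intro image_eqI[of _ _ "Suc i"]) auto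
    qed
  qed auto
  finally show ?thesis by auto
qed

section \<open>Lyndon rotations with respect to a fixed order\<close>

lemma lyndon_wrt_rotate:
  assumes "lyndon_wrt r x" "0 < k" "k < length x"
  shows "(x, rotate k x) \<in> lexord r"
proof -
  have "x = take k x @ drop k x \<and> take k x \<noteq> [] \<and> drop k x \<noteq> []"
    using assms(2,3) by auto
  then have "(x, drop k x @ take k x) \<in> lexord r"
    using assms(1) unfolding lyndon_wrt_def by blast
  then show ?thesis using assms by (simp add: rotate_drop_take)
qed

lemma lyndon_wrt_rotate_rotate:
  assumes "lyndon_wrt r (rotate i w)" "i < length w" "j < length w" "i \<noteq> j"
  shows "(rotate i w, rotate j w) \<in> lexord r"
proof (cases "i < j")
  case True
  with assms lyndon_wrt_rotate[OF assms(1), of "j - i"] show ?thesis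
    by (simp add: rotate_rotate)
next
  case False
  \<comment> \<open>For j < i a full extra turn makes the shift \<open>j + length w - i\<close>
    positive and still smaller than the length.\<close>
  have "rotate (j + length w) w = rotate j w"
    using rotate_conv_mod[of "j + length w" w] rotate_conv_mod[of j w] by simp
  with False assms lyndon_wrt_rotate[OF assms(1), of "j + length w - i"] show ?thesis
    by (simp add: rotate_rotate)
qed

text \<open>Admits arbitrary rotation amounts, since composed rotations can exceed the length;
  distinct words force distinct residues.\<close>

lemma lyndon_wrt_rotate_less:
  assumes "lyndon_wrt r (rotate i w)" "rotate i w \<noteq> rotate j w"
  shows "(rotate i w, rotate j w) \<in> lexord r"
proof -
  have "0 < length w" using assms(2) by auto
  then have "i mod length w < length w" "j mod length w < length w" by simp_all
  moreover have eqs: "rotate (i mod length w) w = rotate i w" "rotate (j mod length w) w = rotate j w"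
    by (simp_all add: rotate_conv_mod[symmetric])
  moreover have "i mod length w \<noteq> j mod length w" using eqs assms(2) by auto
  ultimately show ?thesis
    using lyndon_wrt_rotate_rotate[of r "i mod length w" w "j mod length w"] assms(1) by simp
qed

text \<open>Two such rotations would each be smaller than the other. The conclusion is about
  positions, not words, so that orders chosen for different positions are different.\<close>

lemma lyndon_wrt_unique:
  assumes r: "strict_total_order n r"
    and ij: "i < length w" "j < length w"
    and lyn: "lyndon_wrt r (rotate i w)" "lyndon_wrt r (rotate j w)"
  shows "i = j"
proof (rule ccontr)
  assume "i \<noteq> j"
  then have "(rotate i w, rotate j w) \<in> lexord r" "(rotate j w, rotate i w) \<in> lexord r"
    using lyndon_wrt_rotate_rotate lyn ij by auto
  then have "(rotate i w, rotate i w) \<in> lexord r"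
    using lexord_trans strict_total_orderD(1)[OF r] by blast
  then show False
    using lexord_irreflexive[of r "rotate i w"] strict_total_orderD(2)[OF r]
    by (auto simp: irrefl_def)
qed

text \<open>Pigeonhole: the \<open>fact n\<close> positions choose pairwise distinct orders, and
  there are at most \<open>fact n\<close> of them, so none is missed.\<close>

lemma universal_lyndon_order_realised:
  assumes len: "length w = fact n"
    and lyn: "\<forall>i<length w. \<exists>r. strict_total_order n r \<and> lyndon_wrt r (rotate i w)"
    and r: "strict_total_order n r"
  obtains i where "i < length w" "lyndon_wrt r (rotate i w)"
proof -
  obtain ord where ord: "\<And>i. i < length w \<Longrightarrow> strict_total_order n (ord i)"
    "\<And>i. i < length w \<Longrightarrow> lyndon_wrt (ord i) (rotate i w)"
    using lyn by metis
  have "inj_on ord {..<length w}"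
    by (rule inj_onI) (metis lessThan_iff lyndon_wrt_unique ord)
  then have "card (ord ` {..<length w}) = fact n" by (simp add: card_image len)
  moreover have "ord ` {..<length w} \<subseteq> {r. strict_total_order n r}" using ord by auto
  ultimately have "ord ` {..<length w} = {r. strict_total_order n r}"
    using card_strict_total_orders_le[of n] finite_strict_total_orders[of n]
    by (intro card_seteq) auto
  with r have "r \<in> ord ` {..<length w}" by simp
  with ord that show ?thesis by auto
qed

section \<open>The order of first occurrence\<close>

lemma occ_order_extend:
  obtains r where "strict_total_order n r" "occ_order n u \<subseteq> r"
    "\<And>a b. \<lbrakk>a \<in> set u; b \<in> set u; (a, b) \<in> r\<rbrakk> \<Longrightarrow> (a, b) \<in> occ_order n u"
proof -
  \<comment> \<open>Letters missing from \<open>u\<close> get distinct keys at or beyond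
    \<open>length u\<close>, hence above every first occurrence. On the letters of \<open>u\<close>
    the order by \<open>f\<close> is exactly \<open>occ_order\<close>.\<close>
  define f where "f a = (if a \<in> set u then first_occ u a else length u + a)" for a
  define r where "r = {(i, j). i \<in> {1..n} \<and> j \<in> {1..n} \<and> f i < f j}"
  have "inj_on f {1..n}"
  proof (rule inj_onI)
    fix a b assume eq: "f a = f b"
    have less: "f c < length u \<longleftrightarrow> c \<in> set u" for c
      using nth_first_occ(1)[of c u] by (simp add: f_def)
    show "a = b"
    proof (cases "a \<in> set u")
      case True
      with less eq have "b \<in> set u" by metis
      with True eq have "first_occ u a = first_occ u b" by (simp add: f_def)
      with True \<open>b \<in> set u\<close> show ?thesis by (metis nth_first_occ(2))
    next
      case False
      with less eq have "b \<notin> set u" by metis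
      with False eq show ?thesis by (simp add: f_def)
    qed
  qed
  then have "strict_total_order n r" unfolding r_def by (rule strict_total_order_key)
  moreover have "occ_order n u \<subseteq> r"
    using nth_first_occ(1)[of _ u]
    by (auto simp: occ_order_def r_def f_def intro: trans_less_add1)
  moreover have "(a, b) \<in> occ_order n u" if "a \<in> set u" "b \<in> set u" "(a, b) \<in> r" for a b
    using that by (auto simp: occ_order_def r_def f_def)
  ultimately show thesis using that by blast
qed

text \<open>All conjugates of \<open>u\<close> use only letters of \<open>u\<close>, so only pairs
  of these letters decide the comparisons.\<close>

lemma lyndon_wrt_mono_on:
  assumes "lyndon_wrt r u"
    and "\<And>a b. \<lbrakk>a \<in> set u; b \<in> set u; (a, b) \<in> r\<rbrakk> \<Longrightarrow> (a, b) \<in> s"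
  shows "lyndon_wrt s u"
  unfolding lyndon_wrt_def
proof (intro allI impI)
  fix x y assume *: "u = x @ y \<and> x \<noteq> [] \<and> y \<noteq> []"
  then have "(u, y @ x) \<in> lexord r" using assms(1) by (auto simp: lyndon_wrt_def)
  then show "(u, y @ x) \<in> lexord s"
    by (rule lexord_mono_on) (use * in \<open>auto intro: assms(2)\<close>)
qed

text \<open>This excludes factors \<open>q s p\<close> and \<open>q s q\<close> with \<open>p \<noteq> q\<close> in a universal Lyndon word.\<close>

lemma lyndon_wrt_no_return_to_first:
  assumes r: "strict_total_order n r" and v: "lyndon_wrt r v"
    and v': "(v, v') \<in> lexord r"
    and k: "0 < k" "k < length v" "length v' = length v" "take k v = take k v'"
    and neq: "v ! k \<noteq> v' ! k"
  shows "v' ! k \<noteq> v ! 0"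
proof
  assume ret: "v' ! k = v ! 0"
  note D = strict_total_orderD[OF r]
  obtain m where m: "m < length v" "take m v = take m v'" "(v ! m, v' ! m) \<in> r"
    using lexord_same_length_index[OF v'] k(3) by metis
  \<comment> \<open>The first mismatch is at \<open>k\<close>, so it is there that \<open>v\<close>
    is smaller than \<open>v'\<close>.\<close>
  have "\<not> m < k" using m(3) k(4) D(2) by (metis irrefl_def nth_take)
  moreover have "\<not> k < m" using m(2) neq by (metis nth_take)
  ultimately have "m = k" by simp
  with m ret have down: "(v ! k, v ! 0) \<in> r" by simp
  \<comment> \<open>The rotation starting at \<open>v ! k\<close> is larger than \<open>v\<close>,
    so \<open>v ! k\<close> cannot lie below the first letter.\<close>
  have "(v, rotate k v) \<in> lexord r" using lyndon_wrt_rotate[OF v k(1,2)] .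
  moreover have "rotate k v ! 0 = v ! k"
    using k(2) by (subst nth_rotate) auto
  moreover obtain a xs b ys where "v = a # xs" "rotate k v = b # ys"
    using k(2) by (metis length_greater_0_conv length_rotate list.exhaust list.size(3) not_less_zero)
  ultimately have "(v ! 0, v ! k) \<in> r \<or> v ! 0 = v ! k" by auto
  with down D(1,2) show False by (metis irrefl_def transD)
qed

lemma lyndon_wrt_occ_order:
  assumes len: "length w = fact n"
    and lyn: "\<forall>i<length w. \<exists>r. strict_total_order n r \<and> lyndon_wrt r (rotate i w)"
    and i: "i < length w"
  shows "lyndon_wrt (occ_order n (rotate i w)) (rotate i w)"
proof -
  define u where "u = rotate i w"
  obtain r where r: "strict_total_order n r"
    and occ: "\<And>a b. \<lbrakk>a \<in> set u; b \<in> set u; (a, b) \<in> r\<rbrakk> \<Longrightarrow> (a, b) \<in> occ_order n u"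
    using occ_order_extend[of n u] by metis
  obtain j where j: "j < length w" "lyndon_wrt r (rotate j w)"
    using universal_lyndon_order_realised[OF len lyn r] .
  define u' where "u' = rotate j w"
  have lens: "length u = length w" "length u' = length w" by (auto simp: u_def u'_def)
  have "u = u'"
  proof (rule ccontr)
    assume "u \<noteq> u'"
    then have "(u', u) \<in> lexord r"
      using lyndon_wrt_rotate_less[OF j(2)] unfolding u_def u'_def by auto
    then obtain k where k: "k < length w" "take k u' = take k u" "(u' ! k, u ! k) \<in> r"
      using lexord_same_length_index[of u' u r] lens by metis
    define q l where "q = u' ! k" and "l = first_occ u q"
    have "set u' = set u" by (simp add: u_def u'_def)
    then have mem: "q \<in> set u" "u ! k \<in> set u"
      using k(1) lens by (metis nth_mem q_def, metis nth_mem)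
    \<comment> \<open>Both letters occur in \<open>u\<close>, where \<open>r\<close> agrees with
      first occurrence; so \<open>q\<close> appears before position \<open>k\<close>, inside the
      common prefix.\<close>
    with k(3) occ have "l < first_occ u (u ! k)"
      by (auto simp: occ_order_def q_def l_def)
    also have "\<dots> \<le> k" using k(1) lens by (simp add: first_occ_le)
    finally have l: "l < k" .
    have ql: "u ! l = q" using nth_first_occ[OF mem(1)] by (simp add: l_def)
    have neq: "u ! k \<noteq> q"
      using k(3) strict_total_orderD(2)[OF r] by (auto simp: q_def irrefl_def)
    \<comment> \<open>Rotating by \<open>l\<close> brings this \<open>q\<close> to the front of both
      words and moves the mismatch to \<open>k - l\<close>.\<close>
    define v v' where "v = rotate l u" and "v' = rotate l u'"
    have nth_v: "v ! m = u ! (l + m)" "v' ! m = u' ! (l + m)" if "l + m < length w" for m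
      using that lens by (auto simp: v_def v'_def nth_rotate)
    have v_k: "v ! (k - l) = u ! k" "v' ! (k - l) = q" "v ! 0 = q"
      using nth_v[of "k - l"] nth_v[of 0] l k(1) ql by (auto simp: q_def)
    have take_eq: "take (k - l) v = take (k - l) v'"
    proof (rule nth_equalityI)
      fix m assume "m < length (take (k - l) v)"
      then have "m < k - l" by simp
      then have m: "l + m < k" by simp
      then have "u ! (l + m) = u' ! (l + m)" using k(2) by (metis nth_take)
      with m nth_v[of m] k(1) show "take (k - l) v ! m = take (k - l) v' ! m" by simp
    qed (simp add: v_def v'_def lens)
    have v_rot: "v = rotate (l + i) w" "v' = rotate (l + j) w"
      by (simp_all add: v_def v'_def u_def u'_def rotate_rotate)
    have "(l + i) mod length w < length w" using i by (intro mod_less_divisor) auto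
    \<comment> \<open>The order \<open>s\<close> belongs to the position of \<open>v\<close> and
      need not be \<open>r\<close>.\<close>
    then obtain s where s: "strict_total_order n s" "lyndon_wrt s v"
      using lyn v_rot(1) by (metis rotate_conv_mod)
    have "v \<noteq> v'" using v_k neq by metis
    then have "(v, v') \<in> lexord s"
      using lyndon_wrt_rotate_less s(2) v_rot by metis
    then have "v' ! (k - l) \<noteq> v ! 0"
      by (rule lyndon_wrt_no_return_to_first[OF s])
        (use l k(1) lens take_eq v_k neq in \<open>auto simp: v_def v'_def\<close>)
    with v_k show False by simp
  qed
  with j(2) have "lyndon_wrt r u" by (simp add: u'_def)
  then show ?thesis
    unfolding u_def[symmetric] by (rule lyndon_wrt_mono_on) (rule occ)
qed

theorem theorem1:
  fixes n :: nat and w :: "nat list"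
  assumes "is_word n w" and "length w = fact n"
  shows "universal_lyndon n w \<longleftrightarrow>
    (\<forall>i\<in>{1..length w}. lyndon_wrt (occ_order n (conjugate w i)) (conjugate w i))"
proof -
  have "universal_lyndon n w \<longleftrightarrow> (\<forall>i\<in>{1..length w}. lyndon n (conjugate w i))"
    using assms by (simp add: universal_lyndon_def)
  also have "\<dots> \<longleftrightarrow> (\<forall>i<length w. lyndon n (rotate i w))"
    by (rule all_conjugates_iff)
  also have "\<dots> \<longleftrightarrow>
      (\<forall>i<length w. \<exists>r. strict_total_order n r \<and> lyndon_wrt r (rotate i w))"
    using assms(1) by (simp add: lyndon_def is_word_def)
  also have "\<dots> \<longleftrightarrow> (\<forall>i<length w. lyndon_wrt (occ_order n (rotate i w)) (rotate i w))"
  proof (intro iffI allI impI)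
    fix i assume "\<forall>i<length w. lyndon_wrt (occ_order n (rotate i w)) (rotate i w)" "i < length w"
    then have lyn: "lyndon_wrt (occ_order n (rotate i w)) (rotate i w)" by blast
    \<comment> \<open>A total extension only adds pairs, so every strict comparison under
      \<open>occ_order\<close> survives.\<close>
    obtain r where r: "strict_total_order n r" "occ_order n (rotate i w) \<subseteq> r"
      using occ_order_extend[of n "rotate i w"] by metis
    from lyn have "lyndon_wrt r (rotate i w)"
      by (rule lyndon_wrt_mono_on) (use r(2) in blast)
    with r(1) show "\<exists>r. strict_total_order n r \<and> lyndon_wrt r (rotate i w)" by blast
  qed (use lyndon_wrt_occ_order[OF assms(2)] in blast)
  also have "\<dots> \<longleftrightarrow>
      (\<forall>i\<in>{1..length w}. lyndon_wrt (occ_order n (conjugate w i)) (conjugate w i))"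
    by (rule all_conjugates_iff[symmetric])
  finally show ?thesis .
qed

end
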